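(* Let $M\in\mathbb{N}$ and let $(m_1,\ldots,m_k)$ be a composition of $M$. The number of exact $k$-typed parking functions of order $(m_1,\ldots,m_k)$ is $$\prod_{i=2}^{k}\left(1+\sum_{j=1}^{i-1}m_j\right)^{m_i}.$$
   Context: A composition of $M$ is a sequence $(m_1,\ldots,m_k)$ of positive integers with $m_1+\cdots+m_k=M$. There are $M$ cars, $m_i$ of them of type $i$ (for $1\le i\le k$), and $M$ parking spots in a row. Consider tuples $\alpha=(m_1;P_2,\ldots,P_k)$, where each $P_i=(p^{(i)}_1,\ldots,p^{(i)}_{m_i})$ is an ordered list of nonnegative integers (cars of type 1 have no preference list; for $k=1$, $\alpha=(m_1)$). Such an $\alpha$ is an exact $k$-typed parking function (exact $k$-TPF) of order $(m_1,\ldots,m_k)$ if there is an arrangement of the $M$ cars in the $M$ spots, one car per spot, such that for all $2\le i\le k$ and $1\le j\le m_i$ the $j$-th car of type $i$ has exactly $p^{(i)}_j$ cars of types in $\{1,\ldots,i-1\}$ parked before it. *)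

theory Defs
  imports Main
begin

definition composition :: "nat \<Rightarrow> nat list \<Rightarrow> bool" where
  "composition M ms \<longleftrightarrow> (\<forall>m \<in> set ms. 0 < m) \<and> sum_list ms = M"

text \<open>Types are numbered from 1, whereas list positions start at 0.\<close>

definition num_of_type :: "nat list \<Rightarrow> nat \<Rightarrow> nat" where
  "num_of_type ms i = ms ! (i - 1)"

text \<open>The pair \<open>(i, j)\<close> stands for the \<open>j\<close>-th car of type \<open>i\<close>.\<close>

definition cars :: "nat list \<Rightarrow> (nat \<times> nat) set" where
  "cars ms = {(i, j). i \<in> {1..length ms} \<and> j \<in> {1..num_of_type ms i}}"

definition arrangement :: "nat list \<Rightarrow> (nat \<times> nat \<Rightarrow> nat) \<Rightarrow> bool" where
  "arrangement ms spot \<longleftrightarrow> bij_betw spot (cars ms) {1..sum_list ms}"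

definition lower_before :: "nat list \<Rightarrow> (nat \<times> nat \<Rightarrow> nat) \<Rightarrow> nat \<Rightarrow> nat \<Rightarrow> nat" where
  "lower_before ms spot i j =
     card {c \<in> cars ms. fst c \<in> {1..i - 1} \<and> spot c < spot (i, j)}"

text \<open>A tuple \<open>(m\<^sub>1; P\<^sub>2, \<dots>, P\<^sub>k)\<close> is the pair of \<open>m\<^sub>1\<close> and the list
  \<open>[P\<^sub>2, \<dots>, P\<^sub>k]\<close>, so that \<open>P\<^sub>i\<close> sits at list position \<open>i - 2\<close>. For the empty
  composition, \<^term>\<open>hd ms\<close> is unspecified, and there is exactly one tuple.\<close>

definition exact_TPF :: "nat list \<Rightarrow> nat \<times> nat list list \<Rightarrow> bool" where
  "exact_TPF ms = (\<lambda>(m1, Ps).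
     m1 = hd ms \<and>
     length Ps = length ms - 1 \<and>
     (\<forall>i \<in> {2..length ms}. length (Ps ! (i - 2)) = num_of_type ms i) \<and>
     (\<exists>spot. arrangement ms spot \<and>
        (\<forall>i \<in> {2..length ms}. \<forall>j \<in> {1..num_of_type ms i}.
           lower_before ms spot i j = Ps ! (i - 2) ! (j - 1))))"

end

theory Submission
  imports Defs
begin

text \<open>
  The number of lower-type cars before a car of type \<open>i\<close> is at most
  \<open>s\<^sub>i = m\<^sub>1 + \<dots> + m\<^bsub>i - 1\<^esub>\<close>. The point is that this trivial bound is the only
  constraint: every choice of preferences with entries in \<open>{0..s\<^sub>i}\<close> is realised
  (\<open>exact_TPF_iff\<close>). To see this, build the row by inserting the cars one at a time
  in weakly increasing order of type. A new car may be placed anywhere in the row. As its slot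
  moves from the left end to the right end, the number of lower-type cars before it
  grows from 0 to \<open>s\<^sub>i\<close> in steps of at most 1, so every value is attained. The
  insertion leaves the relative order of the old cars unchanged, and it adds no car of a type
  lower than theirs, so no count that was already correct is disturbed
  (\<open>exists_spots_with_lower_counts\<close>).

  The preference lists can therefore be chosen independently, with \<open>1 + s\<^sub>i\<close>
  possibilities for each of the \<open>m\<^sub>i\<close> entries of \<open>P\<^sub>i\<close>, which gives the product.
\<close>

text \<open>
  A discrete intermediate value argument: the count is 0 for \<open>v = 1\<close>, it is \<open>card L\<close> for
  \<open>v = n + 1\<close>, and it grows by at most 1 in each step because \<open>spot\<close> is injective.
\<close>

lemma exists_slot_after_count:
  fixes spot :: "'a \<Rightarrow> nat"
  assumes inj: "inj_on spot L" and img: "spot ` L \<subseteq> {1..n}" and p: "p \<le> card L"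
  shows "\<exists>v\<in>{1..n + 1}. card {d \<in> L. spot d < v} = p"
proof -
  have fin: "finite L"
    using inj img by (meson finite_atLeastAtMost finite_imageD finite_subset)
  have *: "p \<le> card {d \<in> L. spot d < v + 1} \<Longrightarrow> \<exists>u\<in>{1..v + 1}. card {d \<in> L. spot d < u} = p" for v
  proof (induction v)
    case 0
    have "{d \<in> L. spot d < 0 + 1} = {}"
      using img by fastforce
    then have "card {d \<in> L. spot d < 0 + 1} = p"
      using 0 by (metis card.empty le_zero_eq)
    then show ?case
      by (intro bexI[of _ "0 + 1"]) auto
  next
    case (Suc v)
    let ?E = "{d \<in> L. spot d = v + 1}"
    show ?case
    proof (cases "p \<le> card {d \<in> L. spot d < v + 1}")
      case True
      then show ?thesis
        using Suc.IH by force
    next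
      case False
      have "card ?E \<le> 1"
        using inj fin by (auto simp: card_le_Suc0_iff_eq inj_on_def)
      moreover have "{d \<in> L. spot d < Suc v + 1} = {d \<in> L. spot d < v + 1} \<union> ?E"
        by auto
      then have "card {d \<in> L. spot d < Suc v + 1} \<le> card {d \<in> L. spot d < v + 1} + card ?E"
        by (simp only: card_Un_le)
      ultimately have "card {d \<in> L. spot d < Suc v + 1} = p"
        using False Suc.prems by linarith
      then show ?thesis
        by (intro bexI[of _ "Suc v + 1"]) auto
    qed
  qed
  have "{d \<in> L. spot d < n + 1} = L"
    using img by fastforce
  then show ?thesis
    using *[of n] p by simp
qed

text \<open>
  Induction over the cars in weakly increasing order of type \<open>t\<close>. The new car \<open>x\<close> takes a slot
  \<open>v\<close>, and the cars at \<open>v\<close> and beyond move up by one spot.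
\<close>

lemma exists_spots_with_lower_counts:
  fixes t :: "'a \<Rightarrow> 'b::linorder" and p :: "'a \<Rightarrow> nat"
  assumes "finite S" and "\<forall>c\<in>S. p c \<le> card {d \<in> S. t d < t c}"
  shows "\<exists>spot. bij_betw spot S {1..card S} \<and>
           (\<forall>c\<in>S. card {d \<in> S. t d < t c \<and> spot d < spot c} = p c)"
  using assms
proof (induction S rule: finite_ranking_induct[where f = t])
  case empty
  then show ?case by (simp add: bij_betw_def)
next
  case (insert x S)
  show ?case
  proof (cases "x \<in> S")
    case True
    then show ?thesis
      using insert by (simp add: insert_absorb)
  next
    case False
    have lower: "{d \<in> insert x S. t d < t c} = {d \<in> S. t d < t c}" if "c \<in> insert x S" for c
      using that insert.hyps(2) by fastforce
    then have "\<forall>c\<in>S. p c \<le> card {d \<in> S. t d < t c}"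
      using insert.prems by auto
    then obtain spot where bij: "bij_betw spot S {1..card S}"
      and cnt: "\<And>c. c \<in> S \<Longrightarrow> card {d \<in> S. t d < t c \<and> spot d < spot c} = p c"
      using insert.IH by blast
    let ?L = "{d \<in> S. t d < t x}"
    have "p x \<le> card ?L"
      using insert.prems lower[of x] by auto
    moreover have "inj_on spot ?L" "spot ` ?L \<subseteq> {1..card S}"
      using bij by (auto simp: bij_betw_def inj_on_def)
    ultimately obtain v where v: "v \<in> {1..card S + 1}" "card {d \<in> ?L. spot d < v} = p x"
      using exists_slot_after_count[of spot ?L "card S" "p x"] by auto
    \<comment> \<open>The shift is strictly increasing on the old cars, so it preserves their counts; and an old
      car precedes \<open>x\<close> in the new row exactly if its old spot was below \<open>v\<close>.\<close>
    define spot' where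
      "spot' d = (if d = x then v else if spot d < v then spot d else spot d + 1)" for d
    have inj': "inj_on spot' (insert x S)"
      using bij False by (auto simp: bij_betw_def inj_on_def spot'_def split: if_splits)
    have "spot' ` insert x S \<subseteq> {1..card S + 1}"
      using bij v by (fastforce simp: bij_betw_def spot'_def)
    moreover have "card (spot' ` insert x S) = card S + 1"
      using card_image[OF inj'] False insert.hyps(1) by simp
    ultimately have "spot' ` insert x S = {1..card S + 1}"
      by (intro card_subset_eq) auto
    then have bij': "bij_betw spot' (insert x S) {1..card (insert x S)}"
      using inj' False insert.hyps(1) by (simp add: bij_betw_def)
    have "card {d \<in> insert x S. t d < t c \<and> spot' d < spot' c} = p c" if c: "c \<in> insert x S" for c
    proof (cases "c = x")
      case True
      have "{d \<in> insert x S. t d < t c \<and> spot' d < spot' c} = {d \<in> ?L. spot d < v}"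
        using True False by (auto simp: spot'_def)
      then show ?thesis
        using v True by simp
    next
      case neq: False
      then have "{d \<in> insert x S. t d < t c \<and> spot' d < spot' c}
          = {d \<in> S. t d < t c \<and> spot d < spot c}"
        using c False insert.hyps(2)[of c] by (auto simp: spot'_def split: if_splits)
      then show ?thesis
        using cnt c neq by simp
    qed
    then show ?thesis
      using bij' by blast
  qed
qed

lemma cars_eq_Sigma: "cars ms = (SIGMA i:{1..length ms}. {1..num_of_type ms i})"
  by (auto simp: cars_def)

lemma finite_cars: "finite (cars ms)"
  by (simp add: cars_eq_Sigma)

lemma card_cars: "card (cars ms) = sum_list ms"
proof -
  have "card (cars ms) = (\<Sum>i = 1..length ms. ms ! (i - 1))"
    by (simp add: cars_eq_Sigma num_of_type_def)
  also have "\<dots> = (\<Sum>i < length ms. ms ! i)"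
    by (rule sum.reindex_bij_witness[of _ Suc "\<lambda>i. i - 1"]) auto
  finally show ?thesis
    by (simp add: sum_list_sum_nth atLeast0LessThan)
qed

lemma card_lower_cars:
  assumes "i \<le> length ms"
  shows "card {c \<in> cars ms. fst c \<in> {1..i - 1}} = (\<Sum>j = 1..i - 1. num_of_type ms j)"
proof -
  have "{c \<in> cars ms. fst c \<in> {1..i - 1}} = (SIGMA j:{1..i - 1}. {1..num_of_type ms j})"
    using assms by (auto simp: cars_def)
  then show ?thesis
    by simp
qed

text \<open>
  Necessity holds because the counted cars are among all lower-type cars. For sufficiency the
  cars of type 1 get the preference 0, which they trivially satisfy.
\<close>

lemma exact_TPF_iff:
  "exact_TPF ms (m1, Ps) \<longleftrightarrow> m1 = hd ms \<and> length Ps = length ms - 1 \<and>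
     (\<forall>i \<in> {2..length ms}. length (Ps ! (i - 2)) = num_of_type ms i \<and>
        set (Ps ! (i - 2)) \<subseteq> {0..\<Sum>j = 1..i - 1. num_of_type ms j})"
    (is "?tpf \<longleftrightarrow> ?bounded")
proof
  assume ?tpf
  then obtain spot where
    len: "m1 = hd ms" "length Ps = length ms - 1"
      "\<forall>i \<in> {2..length ms}. length (Ps ! (i - 2)) = num_of_type ms i" and
    pref: "\<forall>i \<in> {2..length ms}. \<forall>j \<in> {1..num_of_type ms i}.
       lower_before ms spot i j = Ps ! (i - 2) ! (j - 1)"
    by (auto simp: exact_TPF_def)
  have "x \<le> (\<Sum>j = 1..i - 1. num_of_type ms j)"
    if i: "i \<in> {2..length ms}" and x: "x \<in> set (Ps ! (i - 2))" for i x
  proof -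
    obtain j where j: "j < num_of_type ms i" "x = Ps ! (i - 2) ! j"
      using x i len(3) by (metis in_set_conv_nth)
    have "x = lower_before ms spot i (Suc j)"
      using pref i j by auto
    also have "\<dots> \<le> card {c \<in> cars ms. fst c \<in> {1..i - 1}}"
      unfolding lower_before_def by (intro card_mono) (auto simp: finite_cars)
    finally show ?thesis
      using i card_lower_cars[of i ms] by simp
  qed
  then show ?bounded
    using len by auto
next
  assume b: ?bounded
  define p where "p = (\<lambda>(i, j). if i = 1 then 0 else Ps ! (i - 2) ! (j - 1))"
  have lower: "{d \<in> cars ms. fst d < i \<and> Q d} = {d \<in> cars ms. fst d \<in> {1..i - 1} \<and> Q d}" for i Q
    by (auto simp: cars_def)
  have "p c \<le> card {d \<in> cars ms. fst d < fst c}" if "c \<in> cars ms" for c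
  proof -
    obtain i j where c: "c = (i, j)" "i \<in> {1..length ms}" "j \<in> {1..num_of_type ms i}"
      using \<open>c \<in> cars ms\<close> by (auto simp: cars_def)
    show ?thesis
    proof (cases "i = 1")
      case True
      then show ?thesis using c by (simp add: p_def)
    next
      case False
      then have i: "i \<in> {2..length ms}"
        using c by auto
      have "Ps ! (i - 2) ! (j - 1) \<in> set (Ps ! (i - 2))"
        using b i c by (intro nth_mem) auto
      moreover have "set (Ps ! (i - 2)) \<subseteq> {0..\<Sum>j = 1..i - 1. num_of_type ms j}"
        using b i by blast
      ultimately have "p c \<le> (\<Sum>j = 1..i - 1. num_of_type ms j)"
        using c False unfolding p_def by auto
      then show ?thesis
        using card_lower_cars[of i ms] lower[of i "\<lambda>_. True"] i c by simp
    qed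
  qed
  then obtain spot where spot: "bij_betw spot (cars ms) {1..card (cars ms)}"
    "\<And>c. c \<in> cars ms \<Longrightarrow> card {d \<in> cars ms. fst d < fst c \<and> spot d < spot c} = p c"
    using exists_spots_with_lower_counts[OF finite_cars, of ms p fst] by blast
  have "lower_before ms spot i j = Ps ! (i - 2) ! (j - 1)"
    if "i \<in> {2..length ms}" "j \<in> {1..num_of_type ms i}" for i j
  proof -
    have "(i, j) \<in> cars ms"
      using that by (auto simp: cars_def)
    from spot(2)[OF this] show ?thesis
      using that lower[of i "\<lambda>d. spot d < spot (i, j)"] by (auto simp: lower_before_def p_def)
  qed
  then show ?tpf
    using b spot(1) by (auto simp: exact_TPF_def arrangement_def card_cars)
qed

lemma card_listset: "card (listset As) = prod_list (map card As)"
proof (induction As)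
  case Nil
  then show ?case by simp
next
  case (Cons A As)
  have "listset (A # As) = (\<lambda>(x, xs). x # xs) ` (A \<times> listset As)"
    by (auto simp: set_Cons_def)
  moreover have "inj_on (\<lambda>(x, xs). x # xs) (A \<times> listset As)"
    by (auto simp: inj_on_def)
  ultimately show ?case
    using Cons.IH by (simp add: card_image card_cartesian_product)
qed

lemma in_listset_iff_nth:
  "xs \<in> listset As \<longleftrightarrow> length xs = length As \<and> (\<forall>i < length As. xs ! i \<in> As ! i)"
proof (induction As arbitrary: xs)
  case Nil
  then show ?case by simp
next
  case (Cons A As)
  then show ?case
    by (cases xs) (auto simp: set_Cons_def less_Suc_eq_0_disj)
qed

theorem theorem3p1:
  fixes M :: nat and ms :: "nat list"
  assumes "composition M ms"
  shows "card {\<alpha>. exact_TPF ms \<alpha>} =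
    (\<Prod>i = 2..length ms. (1 + (\<Sum>j = 1..i - 1. num_of_type ms j)) ^ num_of_type ms i)"
proof -
  define A where "A i = {xs. set xs \<subseteq> {0..\<Sum>j = 1..i - 1. num_of_type ms j} \<and>
      length xs = num_of_type ms i}" for i
  have card_A: "card (A i) = (1 + (\<Sum>j = 1..i - 1. num_of_type ms j)) ^ num_of_type ms i" for i
    unfolding A_def by (subst card_lists_length_eq) auto
  have "exact_TPF ms (m1, Ps) \<longleftrightarrow> m1 = hd ms \<and> Ps \<in> listset (map A [2..<length ms + 1])" for m1 Ps
  proof -
    have "(\<forall>i \<in> {2..length ms}. Ps ! (i - 2) \<in> A i) \<longleftrightarrow> (\<forall>i < length ms - 1. Ps ! i \<in> A (2 + i))"
    proof safe
      fix i assume "\<forall>i \<in> {2..length ms}. Ps ! (i - 2) \<in> A i" "i < length ms - 1"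
      then show "Ps ! i \<in> A (2 + i)"
        by (auto dest!: bspec[of _ _ "2 + i"])
    next
      fix i assume "\<forall>i < length ms - 1. Ps ! i \<in> A (2 + i)" "i \<in> {2..length ms}"
      moreover from this have "2 + (i - 2) = i" "i - 2 < length ms - 1"
        by auto
      ultimately show "Ps ! (i - 2) \<in> A i"
        by metis
    qed
    then show ?thesis
      unfolding exact_TPF_iff in_listset_iff_nth by (auto simp: A_def simp del: upt_Suc)
  qed
  then have "{\<alpha>. exact_TPF ms \<alpha>} = Pair (hd ms) ` listset (map A [2..<length ms + 1])"
    by auto
  then have "card {\<alpha>. exact_TPF ms \<alpha>} = card (listset (map A [2..<length ms + 1]))"
    by (simp add: card_image inj_on_def)
  also have "\<dots> = (\<Prod>i \<in> {2..<length ms + 1}. card (A i))"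
    using prod.distinct_set_conv_list[of "[2..<length ms + 1]" "\<lambda>i. card (A i)"]
    by (simp add: card_listset comp_def del: upt_Suc)
  also have "{2..<length ms + 1} = {2..length ms}"
    by auto
  finally show ?thesis
    by (simp only: card_A)
qed

end
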